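(* Let $H\ge 1$ be an integer, let $M$ be the two-branch MDP with episode length $T=H+2$ described in the context, and let $\phi$ be a state representation (a function on the state space) with $\phi(u_t)=\phi(v_t)$ for all $t=1,\dots,H$. For $a\in\{L,R\}$ let $P_a$ denote the distribution of the observable length-$H$ trajectory segment, seen through $\phi$, when action $a$ is taken at $s_0$. Then the actions $L$ and $R$ at $s_0$ induce identical distributions over all observable length-$H$ trajectory segments, i.e. $P_L=P_R$. Consequently, any learning algorithm whose decision rule depends only on these segments cannot distinguish the optimal action $L$ from the suboptimal action $R$: every function $F$ of the distribution of observable length-$H$ segments satisfies $F(P_L)=F(P_R)$, although $L$ is strictly optimal and $R$ strictly suboptimal for the full-horizon expected return $J=\mathbb{E}\left[\sum_{t=0}^{T-1} r_t\right]$.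
   Context: The two-branch MDP. The states are $s_0,u_1,\dots,u_{H+1},v_1,\dots,v_{H+1},g,b$, where $g$ and $b$ are terminal. At $s_0$ the available actions are $L$ and $R$: $L$ leads deterministically to $u_1$, and $R$ leads deterministically to $v_1$. At every other non-terminal state only a single action is available (the same one, denoted $\ast$), with deterministic transitions $u_t\to u_{t+1}$ and $v_t\to v_{t+1}$ for $t=1,\dots,H$. State $u_{H+1}$ moves to $g$ with reward $1$, and state $v_{H+1}$ moves to $b$ with reward $0$. All other rewards are $0$. Observable segments. The offline dataset consists exclusively of cropped trajectory windows of length $H$ that begin after the initial action and that never contain the states $u_{H+1}$ or $v_{H+1}$ (nor the terminal states). Thus a window contains $H$ consecutive states, namely $u_1,\dots,u_H$ or $v_1,\dots,v_H$, with the actions taken between them. The learner sees the states of a window only through $\phi$, so it observes $(\phi(x_1),\ast,\phi(x_2),\ast,\dots,\phi(x_H))$ with $x_t=u_t$ (if $L$ was taken) or $x_t=v_t$ (if $R$ was taken). The initial action is not recorded. *)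

theory Defs
  imports "HOL-Probability.Probability_Mass_Function"
begin

section \<open>Episodic decision processes\<close>

record ('s, 'a) mdp =
  states :: "'s set"
  initial :: 's
  terminal :: "'s set"
  avail :: "'s \<Rightarrow> 'a set"
  trans :: "'s \<Rightarrow> 'a \<Rightarrow> 's pmf"
  reward :: "'s \<Rightarrow> 'a \<Rightarrow> 's \<Rightarrow> real"
  horizon :: nat

text \<open>
  A trajectory consists of the transitions made so far, in chronological order and each recorded
  as (state, action, reward), together with the current state.
\<close>

type_synonym ('s, 'a) history = "('s \<times> 'a \<times> real) list"
type_synonym ('s, 'a) trajectory = "('s, 'a) history \<times> 's"
type_synonym ('s, 'a) policy = "('s, 'a) history \<Rightarrow> 's \<Rightarrow> 'a pmf"

text \<open>Policies may be randomised and history dependent.\<close>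

definition policies :: "('s, 'a) mdp \<Rightarrow> ('s, 'a) policy set" where
  "policies M = {\<pi>. \<forall>h. \<forall>s \<in> states M - terminal M. set_pmf (\<pi> h s) \<subseteq> avail M s}"

definition step :: "('s, 'a) mdp \<Rightarrow> ('s, 'a) policy \<Rightarrow> ('s, 'a) trajectory \<Rightarrow> ('s, 'a) trajectory pmf"
where
  "step M \<pi> \<tau> = (case \<tau> of (h, s) \<Rightarrow>
     if s \<in> terminal M then return_pmf (h, s)
     else bind_pmf (\<pi> h s) (\<lambda>a.
       map_pmf (\<lambda>s'. (h @ [(s, a, reward M s a s')], s')) (trans M s a)))"

primrec rollout :: "('s, 'a) mdp \<Rightarrow> ('s, 'a) policy \<Rightarrow> nat \<Rightarrow> ('s, 'a) trajectory pmf" where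
  "rollout M \<pi> 0 = return_pmf ([], initial M)"
| "rollout M \<pi> (Suc n) = bind_pmf (rollout M \<pi> n) (step M \<pi>)"

abbreviation episode :: "('s, 'a) mdp \<Rightarrow> ('s, 'a) policy \<Rightarrow> ('s, 'a) trajectory pmf" where
  "episode M \<pi> \<equiv> rollout M \<pi> (horizon M)"

text \<open>An episode stopped early at a terminal state collects no further reward.\<close>

definition reward_at :: "('s, 'a) trajectory \<Rightarrow> nat \<Rightarrow> real" where
  "reward_at \<tau> t = (if t < length (fst \<tau>) then snd (snd (fst \<tau> ! t)) else 0)"

definition expected_return :: "('s, 'a) mdp \<Rightarrow> ('s, 'a) policy \<Rightarrow> real" where
  "expected_return M \<pi> =
     measure_pmf.expectation (episode M \<pi>) (\<lambda>\<tau>. \<Sum>t<horizon M. reward_at \<tau> t)"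

definition optimal_value :: "('s, 'a) mdp \<Rightarrow> real" where
  "optimal_value M = (SUP \<pi> \<in> policies M. expected_return M \<pi>)"

definition action_value :: "('s, 'a) mdp \<Rightarrow> 'a \<Rightarrow> real" where
  "action_value M a =
     (SUP \<pi> \<in> {\<pi> \<in> policies M. \<pi> [] (initial M) = return_pmf a}. expected_return M \<pi>)"

definition strictly_optimal_action :: "('s, 'a) mdp \<Rightarrow> 'a \<Rightarrow> bool" where
  "strictly_optimal_action M a \<longleftrightarrow>
     a \<in> avail M (initial M) \<and> action_value M a = optimal_value M \<and>
     (\<forall>a' \<in> avail M (initial M) - {a}. action_value M a' < action_value M a)"

definition strictly_suboptimal_action :: "('s, 'a) mdp \<Rightarrow> 'a \<Rightarrow> bool" where
  "strictly_suboptimal_action M a \<longleftrightarrow>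
     a \<in> avail M (initial M) \<and> action_value M a < optimal_value M"


section \<open>Cropped windows\<close>

definition state_seq :: "('s, 'a) trajectory \<Rightarrow> 's list" where
  "state_seq \<tau> = map fst (fst \<tau>) @ [snd \<tau>]"

definition action_seq :: "('s, 'a) trajectory \<Rightarrow> 'a list" where
  "action_seq \<tau> = map (fst \<circ> snd) (fst \<tau>)"

text \<open>
  A segment lists the consecutive states of a window and, separately, the actions taken between
  them. Starting at a position \<open>k \<ge> 1\<close> means starting after the initial action.
\<close>

type_synonym ('s, 'a) segment = "'s list \<times> 'a list"

definition windows :: "nat \<Rightarrow> 's set \<Rightarrow> ('s, 'a) trajectory \<Rightarrow> ('s, 'a) segment set" where
  "windows n hidden \<tau> =
     {(take n (drop k (state_seq \<tau>)), take (n - 1) (drop k (action_seq \<tau>))) | k.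
        1 \<le> k \<and> k + n \<le> length (state_seq \<tau>) \<and>
        set (take n (drop k (state_seq \<tau>))) \<inter> hidden = {}}"

definition observe :: "('s \<Rightarrow> 'o) \<Rightarrow> ('s, 'a) segment \<Rightarrow> ('o, 'a) segment" where
  "observe \<phi> w = (map \<phi> (fst w), snd w)"


section \<open>The two-branch process\<close>

datatype state = S0 | U nat | V nat | G | B
datatype action = L | R | Star

fun next_state :: "nat \<Rightarrow> state \<Rightarrow> action \<Rightarrow> state" where
  "next_state H S0 a = (if a = L then U 1 else V 1)"
| "next_state H (U t) a = (if t \<le> H then U (t + 1) else G)"
| "next_state H (V t) a = (if t \<le> H then V (t + 1) else B)"
| "next_state H G a = G"
| "next_state H B a = B"

definition two_branch :: "nat \<Rightarrow> (state, action) mdp" where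
  "two_branch H = \<lparr>
     states = {S0, G, B} \<union> U ` {1..H + 1} \<union> V ` {1..H + 1},
     initial = S0,
     terminal = {G, B},
     avail = (\<lambda>s. if s = S0 then {L, R} else {Star}),
     trans = (\<lambda>s a. return_pmf (next_state H s a)),
     reward = (\<lambda>s a s'. if s = U (H + 1) then 1 else 0),
     horizon = H + 2\<rparr>"

text \<open>All choices after the first are forced, so an episode is determined by the initial action.\<close>

definition branch_policy :: "action \<Rightarrow> (state, action) policy" where
  "branch_policy a h s = return_pmf (if s = S0 then a else Star)"

definition hidden_states :: "nat \<Rightarrow> state set" where
  "hidden_states H = {U (H + 1), V (H + 1), G, B}"

text \<open>
  The definite description is justified by \<open>windows_branch\<close> below: every episode of the process
  has exactly one admissible window of length \<open>H\<close>.
\<close>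

definition segment_of :: "nat \<Rightarrow> (state, action) trajectory \<Rightarrow> (state, action) segment" where
  "segment_of H \<tau> = (THE w. w \<in> windows H (hidden_states H) \<tau>)"

definition segment_dist :: "nat \<Rightarrow> (state \<Rightarrow> 'o) \<Rightarrow> action \<Rightarrow> ('o, action) segment pmf" where
  "segment_dist H \<phi> a =
     map_pmf (observe \<phi> \<circ> segment_of H) (episode (two_branch H) (branch_policy a))"


subsection \<open>Uniqueness of the window\<close>

fun branch_state :: "action \<Rightarrow> nat \<Rightarrow> state" where
  "branch_state L t = U t"
| "branch_state _ t = V t"

lemma branch_policy_in_policies:
  assumes "a \<in> {L, R}"
  shows "branch_policy a \<in> policies (two_branch H)"
  using assms by (auto simp: policies_def branch_policy_def two_branch_def)

lemma rollout_branch: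
  assumes "a \<in> {L, R}" "n \<le> H"
  shows "rollout (two_branch H) (branch_policy a) (Suc n) =
    return_pmf ((S0, a, 0) # map (\<lambda>t. (branch_state a t, Star, 0)) [1..<n + 1],
                branch_state a (n + 1))"
  using assms(2)
proof (induction n)
  case 0
  show ?case using assms(1)
    by (auto simp: step_def two_branch_def branch_policy_def bind_return_pmf)
next
  case (Suc n)
  then have "rollout (two_branch H) (branch_policy a) (Suc (Suc n)) =
    step (two_branch H) (branch_policy a)
      ((S0, a, 0) # map (\<lambda>t. (branch_state a t, Star, 0)) [1..<n + 1], branch_state a (n + 1))"
    by (subst rollout.simps(2)) (simp only: Suc_leD bind_return_pmf)
  also have "\<dots> = return_pmf ((S0, a, 0) # map (\<lambda>t. (branch_state a t, Star, 0)) [1..<Suc n + 1],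
                branch_state a (Suc n + 1))"
    using assms(1) Suc.prems
    by (auto simp: step_def two_branch_def branch_policy_def bind_return_pmf)
  finally show ?case .
qed

lemma episode_branch:
  assumes "a \<in> {L, R}"
  shows "episode (two_branch H) (branch_policy a) =
    return_pmf ((S0, a, 0) # map (\<lambda>t. (branch_state a t, Star, 0)) [1..<H + 1] @
                  [(branch_state a (H + 1), Star, if a = L then 1 else 0)],
                if a = L then G else B)"
proof -
  have "episode (two_branch H) (branch_policy a) =
    rollout (two_branch H) (branch_policy a) (Suc (Suc H))"
    by (simp add: two_branch_def)
  also have "\<dots> = step (two_branch H) (branch_policy a)
      ((S0, a, 0) # map (\<lambda>t. (branch_state a t, Star, 0)) [1..<H + 1], branch_state a (H + 1))"
    by (subst rollout.simps(2)) (simp only: rollout_branch[OF assms order_refl] bind_return_pmf)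
  also have "\<dots> = return_pmf ((S0, a, 0) # map (\<lambda>t. (branch_state a t, Star, 0)) [1..<H + 1] @
                  [(branch_state a (H + 1), Star, if a = L then 1 else 0)],
                if a = L then G else B)"
    using assms by (auto simp: step_def two_branch_def branch_policy_def bind_return_pmf)
  finally show ?thesis .
qed

lemma windows_branch:
  assumes "H \<ge> 1" "a \<in> {L, R}" "\<tau> \<in> set_pmf (episode (two_branch H) (branch_policy a))"
  shows "windows H (hidden_states H) \<tau> =
    {(map (branch_state a) [1..<H + 1], replicate (H - 1) Star)}"
proof -
  define us where "us = map (branch_state a) [1..<H + 1]"
  define e where "e = (if a = L then G else B)"
  have len: "length us = H" by (simp add: us_def)
  have ss: "state_seq \<tau> = S0 # us @ [branch_state a (H + 1), e]"
    using assms(3) by (auto simp: episode_branch[OF assms(2)] state_seq_def us_def e_def o_def)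
  have as: "action_seq \<tau> = a # replicate (H + 1) Star"
    using assms(3)
    by (auto simp: episode_branch[OF assms(2)] action_seq_def o_def map_replicate_const
        simp flip: replicate_append_same)
  have hid: "{branch_state a (H + 1), e} \<subseteq> hidden_states H" "set us \<inter> hidden_states H = {}"
    using assms(2) by (auto simp: hidden_states_def us_def e_def)
  have win: "1 \<le> k \<and> k + n \<le> H + 3 \<and>
      set (take n (drop k (state_seq \<tau>))) \<inter> hidden_states H = {} \<longleftrightarrow> k = 1" if n: "n = H" for k n
  proof -
    have "k = 1" if k: "1 \<le> k" "k + n \<le> H + 3"
      "set (take n (drop k (state_seq \<tau>))) \<inter> hidden_states H = {}"
    proof (rule ccontr)
      assume "k \<noteq> 1"
      with k n consider "k = 2" | "k = 3" by linarith
      then have "last (take n (drop k (state_seq \<tau>))) \<in> {branch_state a (H + 1), e}"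
      proof cases
        case 1
        then have "take n (drop k (state_seq \<tau>)) = drop 1 us @ [branch_state a (H + 1)]"
          using n len assms(1) by (simp add: ss drop_Cons' numeral_2_eq_2)
        then show ?thesis by simp
      next
        case 2
        then have "take n (drop k (state_seq \<tau>)) = drop 2 (us @ [branch_state a (H + 1), e])"
          using n len assms(1) by (simp add: ss numeral_3_eq_3 numeral_2_eq_2)
        then show ?thesis using len assms(1) by (simp add: drop_append last_append drop_Cons')
      qed
      moreover have "take n (drop k (state_seq \<tau>)) \<noteq> []"
        using k n assms(1) len by (auto simp: ss)
      ultimately show False using hid(1) k(3) last_in_set by blast
    qed
    moreover have "set (take n (drop 1 (state_seq \<tau>))) \<inter> hidden_states H = {}"
      using n len hid(2) by (simp add: ss)
    ultimately show ?thesis using n by auto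
  qed
  have "windows H (hidden_states H) \<tau> =
      {(take H (drop 1 (state_seq \<tau>)), take (H - 1) (drop 1 (action_seq \<tau>)))}"
    using win[OF refl] len unfolding windows_def by (auto simp: ss)
  also have "\<dots> = {(us, replicate (H - 1) Star)}"
    using len by (simp add: ss as min_def flip: replicate_Suc)
  finally show ?thesis by (simp add: us_def)
qed

end

theory Submission
  imports Defs
begin

text \<open>
  The window of each branch is unique, and \<open>\<phi>\<close> identifies the two windows. For the returns, every
  policy is, from its first action onwards, a branch policy; hence its expected return is the
  probability with which it plays \<open>L\<close> at the initial state.
\<close>

text \<open>On the support of the episode \<open>windows_branch\<close> resolves the definite
  description in \<open>segment_of\<close> to one fixed window, so the pushforward is a point
  mass.\<close>

lemma segment_dist_branch:
  assumes "H \<ge> 1" "a \<in> {L, R}"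
  shows "segment_dist H \<phi> a =
    return_pmf (map (\<phi> \<circ> branch_state a) [1..<H + 1], replicate (H - 1) Star)"
proof -
  have "segment_dist H \<phi> a =
    map_pmf (\<lambda>_. (map (\<phi> \<circ> branch_state a) [1..<H + 1], replicate (H - 1) Star))
      (episode (two_branch H) (branch_policy a))"
    unfolding segment_dist_def
    by (intro map_pmf_cong refl)
      (simp add: segment_of_def windows_branch[OF assms] observe_def del: upt_Suc)
  then show ?thesis by simp
qed

lemma policy_initial:
  assumes "\<pi> \<in> policies (two_branch H)"
  shows "set_pmf (\<pi> [] S0) \<subseteq> {L, R}"
proof -
  have "S0 \<in> states (two_branch H) - terminal (two_branch H)"
    by (simp add: two_branch_def)
  then have "set_pmf (\<pi> [] S0) \<subseteq> avail (two_branch H) S0"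
    using assms unfolding policies_def by blast
  then show ?thesis by (simp add: two_branch_def)
qed

text \<open>Away from \<open>S0\<close> a non-terminal state offers only \<open>Star\<close>, which
  forces \<open>\<pi> h s\<close> whatever the history. The action \<open>a\<close> is arbitrary
  because \<open>branch_policy a\<close> consults it only at \<open>S0\<close>.\<close>

lemma step_eq_branch_step:
  assumes "\<pi> \<in> policies (two_branch H)" "s \<in> states (two_branch H)" "s \<noteq> S0"
  shows "step (two_branch H) \<pi> (h, s) = step (two_branch H) (branch_policy a) (h, s)"
proof (cases "s \<in> terminal (two_branch H)")
  case True
  then show ?thesis by (simp add: step_def)
next
  case False
  then have "set_pmf (\<pi> h s) \<subseteq> avail (two_branch H) s"
    using assms(1,2) unfolding policies_def by blast
  then have "\<pi> h s = branch_policy a h s"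
    using assms(3) by (simp add: two_branch_def branch_policy_def set_pmf_subset_singleton)
  then show ?thesis by (simp add: step_def)
qed

text \<open>The only free choice is the first action, so after at least one step a policy is a
  mixture of branch policies. The bound on \<open>n\<close> lets \<open>Suc n\<close> reach the
  horizon \<open>H + 2\<close>.\<close>

lemma rollout_eq_bind_branch:
  assumes "\<pi> \<in> policies (two_branch H)" "n \<le> H + 1"
  shows "rollout (two_branch H) \<pi> (Suc n) =
    bind_pmf (\<pi> [] S0) (\<lambda>a. rollout (two_branch H) (branch_policy a) (Suc n))"
  using assms(2)
proof (induction n)
  case 0
  show ?case
    by (simp add: step_def two_branch_def branch_policy_def bind_return_pmf)
next
  case (Suc n)
  then have "rollout (two_branch H) \<pi> (Suc (Suc n)) =
    bind_pmf (\<pi> [] S0) (\<lambda>a. bind_pmf (rollout (two_branch H) (branch_policy a) (Suc n))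
      (step (two_branch H) \<pi>))"
    by (subst rollout.simps(2)) (simp only: Suc_leD bind_assoc_pmf)
  also have "\<dots> = bind_pmf (\<pi> [] S0) (\<lambda>a. rollout (two_branch H) (branch_policy a) (Suc (Suc n)))"
  proof (intro bind_pmf_cong refl)
    fix a assume "a \<in> set_pmf (\<pi> [] S0)"
    then have a: "a \<in> {L, R}" using policy_initial[OF assms(1)] by blast
    have n: "n \<le> H" using Suc.prems by simp
    have s: "branch_state a (n + 1) \<in> states (two_branch H)" "branch_state a (n + 1) \<noteq> S0"
      using a n by (auto simp: two_branch_def)
    show "bind_pmf (rollout (two_branch H) (branch_policy a) (Suc n)) (step (two_branch H) \<pi>) =
      rollout (two_branch H) (branch_policy a) (Suc (Suc n))"
      \<comment> \<open>For \<open>n \<le> H\<close> the branch rollout is a point mass at a state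
        other than \<open>S0\<close>, so both sides reduce to a single forced step.\<close>
      unfolding rollout.simps(2)[of _ _ "Suc n"] rollout_branch[OF a n] bind_return_pmf
      by (rule step_eq_branch_step[OF assms(1) s])
  qed
  finally show ?case .
qed

lemma branch_return:
  assumes "a \<in> {L, R}" "\<tau> \<in> set_pmf (episode (two_branch H) (branch_policy a))"
  shows "(\<Sum>t<horizon (two_branch H). reward_at \<tau> t) = indicator {L} a"
proof -
  \<comment> \<open>Index 0 records the step from \<open>S0\<close> and index \<open>t\<close> the
    step from \<open>branch_state a t\<close>, so the only possibly nonzero reward sits at the last
    index, \<open>H + 1\<close>.\<close>
  have "reward_at \<tau> t = (if t = H + 1 then indicator {L} a else 0)" if "t < H + 2" for t
    using assms that
    by (auto simp: episode_branch[OF assms(1)] reward_at_def nth_append nth_Cons'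
        simp del: upt_Suc)
  then show ?thesis by (simp add: two_branch_def)
qed

lemma expected_return_two_branch:
  assumes "\<pi> \<in> policies (two_branch H)"
  shows "expected_return (two_branch H) \<pi> = pmf (\<pi> [] S0) L"
proof -
  let ?G = "\<lambda>\<tau>. \<Sum>t<horizon (two_branch H). reward_at \<tau> t"
  have "episode (two_branch H) \<pi> =
      bind_pmf (\<pi> [] S0) (\<lambda>a. episode (two_branch H) (branch_policy a))"
    using rollout_eq_bind_branch[OF assms, of "H + 1"] by (simp add: two_branch_def)
  \<comment> \<open>Working with the law of the return, rather than its integral, avoids exchanging
    an expectation with \<open>bind_pmf\<close>.\<close>
  then have "map_pmf ?G (episode (two_branch H) \<pi>) =
      bind_pmf (\<pi> [] S0) (\<lambda>a. map_pmf ?G (episode (two_branch H) (branch_policy a)))"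
    by (simp only: map_bind_pmf)
  also have "\<dots> = bind_pmf (\<pi> [] S0) (\<lambda>a. return_pmf (indicator {L} a))"
  proof (intro bind_pmf_cong refl)
    fix a assume "a \<in> set_pmf (\<pi> [] S0)"
    then have "a \<in> {L, R}" using policy_initial[OF assms] by blast
    then have "map_pmf ?G (episode (two_branch H) (branch_policy a)) =
        map_pmf (\<lambda>_. indicator {L} a) (episode (two_branch H) (branch_policy a))"
      by (intro map_pmf_cong refl branch_return)
    then show "map_pmf ?G (episode (two_branch H) (branch_policy a)) =
        return_pmf (indicator {L} a)" by simp
  qed
  also have "\<dots> = map_pmf (indicator {L}) (\<pi> [] S0)"
    by (simp add: map_pmf_def)
  finally have "measure_pmf.expectation (map_pmf ?G (episode (two_branch H) \<pi>)) (\<lambda>x. x) =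
      measure_pmf.expectation (map_pmf (indicator {L}) (\<pi> [] S0)) (\<lambda>x. x)"
    by simp
  then show ?thesis
    by (simp add: expected_return_def measure_pmf_single)
qed

lemma optimal_value_two_branch: "optimal_value (two_branch H) = 1"
proof -
  have L: "branch_policy L \<in> policies (two_branch H)"
    by (simp add: branch_policy_in_policies)
  have "expected_return (two_branch H) (branch_policy L) = 1"
    by (simp add: expected_return_two_branch[OF L] branch_policy_def)
  then show ?thesis
    unfolding optimal_value_def
    \<comment> \<open>The value 1 is attained by \<open>branch_policy L\<close> and bounds every
      return, since each return is a probability.\<close>
    by (intro cSup_eq_maximum)
      (use L in \<open>force simp: expected_return_two_branch pmf_le_1\<close>)+
qed

lemma action_value_two_branch:
  assumes "a \<in> {L, R}"
  shows "action_value (two_branch H) a = indicator {L} a"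
proof -
  have S0: "initial (two_branch H) = S0"
    by (simp add: two_branch_def)
  let ?P = "{\<pi> \<in> policies (two_branch H). \<pi> [] (initial (two_branch H)) = return_pmf a}"
  have "branch_policy a \<in> ?P"
    using branch_policy_in_policies[OF assms] by (simp add: branch_policy_def S0)
  moreover have "expected_return (two_branch H) \<pi> = indicator {L} a" if "\<pi> \<in> ?P" for \<pi>
    using that by (auto simp: expected_return_two_branch S0 indicator_def)
  ultimately have "expected_return (two_branch H) ` ?P = {indicator {L} a}"
    by (intro equalityI image_subsetI) (auto intro: rev_image_eqI)
  then show ?thesis by (simp add: action_value_def)
qed

theorem proposition3:
  fixes H :: nat and \<phi> :: "state \<Rightarrow> 'o"
  assumes "H \<ge> 1"
    and "\<forall>t \<in> {1..H}. \<phi> (U t) = \<phi> (V t)"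
  shows "segment_dist H \<phi> L = segment_dist H \<phi> R \<and>
    (\<forall>F :: ('o, action) segment pmf \<Rightarrow> 'd. F (segment_dist H \<phi> L) = F (segment_dist H \<phi> R)) \<and>
    strictly_optimal_action (two_branch H) L \<and>
    strictly_suboptimal_action (two_branch H) R"
proof -
  \<comment> \<open>The window visits only indices 1 to \<open>H\<close>, exactly those where
    \<open>\<phi>\<close> merges the branches.\<close>
  have "map (\<phi> \<circ> branch_state L) [1..<H + 1] = map (\<phi> \<circ> branch_state R) [1..<H + 1]"
    using assms(2) by (auto simp del: upt_Suc)
  then have "segment_dist H \<phi> L = segment_dist H \<phi> R"
    using assms(1) by (simp add: segment_dist_branch del: upt_Suc)
  moreover have "avail (two_branch H) (initial (two_branch H)) = {L, R}"
    by (simp add: two_branch_def)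
  then have "strictly_optimal_action (two_branch H) L" "strictly_suboptimal_action (two_branch H) R"
    by (auto simp: strictly_optimal_action_def strictly_suboptimal_action_def
        action_value_two_branch optimal_value_two_branch)
  ultimately show ?thesis by simp
qed

end
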